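(* Let $\mu>-1$, $q>-1$ and $0<\gamma<1$. As $x\downarrow0$, $$R_{\mu,q,\gamma}(x)=\frac{2(\mu+1)}{q+1}\left[1+\frac{\gamma x}{q+2}+\left\{\frac{\gamma^2}{(q+2)(q+3)}+\frac{q+1}{4(\mu+1)(q+3)}-\frac1{4(\mu+2)}\right\}x^2+O(x^3)\right].$$ As $x\to\infty$, $$R_{\mu,q,\gamma}(x)=\frac1{1-\gamma}+\frac{(\mu+1/2)(2-\gamma)-q}{(1-\gamma)^2x}+O(x^{-2}).$$
   Context: $I_\alpha(x)=\sum_{k=0}^{\infty}\frac{(x/2)^{2k+\alpha}}{k!\,\Gamma(k+\alpha+1)}$, $x>0$, is the modified Bessel function of the first kind. For $x>0$, $$R_{\mu,q,\gamma}(x)=\frac{\int_0^x e^{-\gamma t}t^{q-\mu}I_\mu(t)\,dt}{e^{-\gamma x}x^{q-\mu}I_{\mu+1}(x)}.$$ The implied constants may depend on $\mu,q,\gamma$. *)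

theory Defs
  imports "HOL-Analysis.Analysis" "HOL-Library.Landau_Symbols"
begin

text \<open>
  Modified Bessel function of the first kind, meant for \<^term>\<open>x > 0\<close>. The library's
  \<^term>\<open>Gamma\<close> is 0 at its poles and division by 0 gives 0, so that those terms of the series
  vanish, in line with the convention that the reciprocal Gamma function is entire.
\<close>
definition besselI :: "real \<Rightarrow> real \<Rightarrow> real" where
  "besselI \<alpha> x =
     (\<Sum>k. (x / 2) powr (2 * real k + \<alpha>) / (fact k * Gamma (real k + \<alpha> + 1)))"

text \<open>
  The value of the integrand at 0 is irrelevant. For \<^term>\<open>\<mu> > -1\<close> it is positive on
  the open interval from 0 to \<^term>\<open>x\<close>, so the Henstock-Kurzweil integral agrees with the
  Lebesgue integral; for \<^term>\<open>-1 < q \<and> q < 0\<close> it is unbounded near 0, but still integrable.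
\<close>
definition R_ratio :: "real \<Rightarrow> real \<Rightarrow> real \<Rightarrow> real \<Rightarrow> real" where
  "R_ratio \<mu> q \<gamma> x =
     integral {0..x} (\<lambda>t. exp (- \<gamma> * t) * t powr (q - \<mu>) * besselI \<mu> t)
     / (exp (- \<gamma> * x) * x powr (q - \<mu>) * besselI (\<mu> + 1) x)"

end

theory Submission
  imports Defs
begin

text \<open>
  The behaviour at 0 is a matter of power series and the behaviour at infinity one of differential
  equations.

  Write the modified Bessel functions through the entire Bessel--Clifford functions. The ratio then becomes
  an integral of \<^term>\<open>t powr q\<close> against a smooth function, divided by
  \<^term>\<open>x powr (q + 1)\<close> and by a smooth positive function. Near 0, Taylor polynomials of the smooth
  functions can be integrated term by term (\<open>integral_powr_expansion\<close>) and multiplied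
  (\<open>bigo_quadratic_mult\<close>), and the first expansion follows by comparing coefficients.

  At infinity the asymptotic expansion of the Bessel functions themselves is avoided. The quotient
  \<^term>\<open>u\<close> of the Bessel functions of orders \<^term>\<open>\<mu>\<close> and \<^term>\<open>\<mu> + 1\<close>
  solves the Riccati equation \<open>u' = 1 + (2 * \<mu> + 1) * u / x - u\<^sup>2\<close>, and the ratio \<open>R\<close>
  of the theorem solves the linear equation \<open>R' = u - (u - \<gamma> + (q - 2 * \<mu> - 1) / x) * R\<close>.
  For each equation a function of the form \<^term>\<open>A + B / x\<close> is a solution up to
  \<open>O(1 / x\<^sup>2)\<close>, and the difference from the true solution satisfies a linear equation
  \<open>e' = g - p * e\<close> with forcing term \<open>g = O(1 / x\<^sup>2)\<close> and damping \<^term>\<open>p\<close>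
  bounded below by a positive constant. The energy estimate \<open>damped_ode_bigo\<close> turns this into
  \<open>e = O(1 / x\<^sup>2)\<close>. It is applied to \<^term>\<open>u\<close>, which is positive, and then,
  with \<open>u = 1 + (\<mu> + 1 / 2) / x + O(1 / x\<^sup>2)\<close> at hand, to the ratio, whose damping tends to
  \<^term>\<open>1 - \<gamma>\<close>.
\<close>

section \<open>Taylor polynomials at 0\<close>

lemma bigo_cmult:
  fixes f g :: "real \<Rightarrow> real"
  assumes "f \<in> O[F](g)"
  shows "(\<lambda>x. c * f x) \<in> O[F](g)"
  using assms by (cases "c = 0") simp_all

lemma bigo_1_at_right_0:
  fixes f :: "real \<Rightarrow> real"
  assumes "isCont f 0"
  shows "f \<in> O[at_right 0](\<lambda>_. 1)"
proof (rule bigoI_tendsto)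
  show "((\<lambda>x. f x / 1) \<longlongrightarrow> f 0) (at_right 0)"
    using assms by (simp add: isCont_def filterlim_at_split)
qed simp

text \<open>
  The coefficients are those of the product of the quadratics; their product differs from this
  truncation by \<^term>\<open>x ^ 3\<close> times a polynomial.
\<close>
lemma bigo_quadratic_mult:
  fixes f g :: "real \<Rightarrow> real"
  assumes f: "(\<lambda>x. f x - (a0 + a1 * x + a2 * x\<^sup>2)) \<in> O[at_right 0](\<lambda>x. x ^ 3)"
    and g: "(\<lambda>x. g x - (b0 + b1 * x + b2 * x\<^sup>2)) \<in> O[at_right 0](\<lambda>x. x ^ 3)"
    and g1: "isCont g 0"
  shows "(\<lambda>x. f x * g x - (a0 * b0 + (a0 * b1 + a1 * b0) * x + (a0 * b2 + a1 * b1 + a2 * b0) * x\<^sup>2))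
    \<in> O[at_right 0](\<lambda>x. x ^ 3)"
proof -
  define P where "P x = a0 + a1 * x + a2 * x\<^sup>2" for x
  define Q where "Q x = b0 + b1 * x + b2 * x\<^sup>2" for x
  define S where "S x = a1 * b2 + a2 * b1 + a2 * b2 * x" for x
  have cont: "isCont P 0" "isCont S 0"
    unfolding P_def S_def by (intro continuous_intros)+
  have "(\<lambda>x. (f x - P x) * g x) \<in> O[at_right 0](\<lambda>x. x ^ 3 * 1)"
    "(\<lambda>x. P x * (g x - Q x)) \<in> O[at_right 0](\<lambda>x. 1 * x ^ 3)"
    "(\<lambda>x. S x * x ^ 3) \<in> O[at_right 0](\<lambda>x. 1 * x ^ 3)"
    using f g unfolding P_def[symmetric] Q_def[symmetric]
    by (intro landau_o.big.mult bigo_1_at_right_0 g1 cont; simp)+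
  then have "(\<lambda>x. (f x - P x) * g x + P x * (g x - Q x) + S x * x ^ 3) \<in> O[at_right 0](\<lambda>x. x ^ 3)"
    by (intro sum_in_bigo) auto
  moreover have "(f x - P x) * g x + P x * (g x - Q x) + S x * x ^ 3 = f x * g x
      - (a0 * b0 + (a0 * b1 + a1 * b0) * x + (a0 * b2 + a1 * b1 + a2 * b0) * x\<^sup>2)" for x
    unfolding P_def Q_def S_def by (simp add: algebra_simps power2_eq_square power3_eq_cube)
  ultimately show ?thesis by simp
qed

text \<open>
  This is Taylor's theorem with Lagrange remainder; the highest derivative is bounded near 0
  because it is differentiable. Listing all derivatives as one sequence of functions suits the
  Bessel--Clifford functions, whose derivatives are again members of the family.
\<close>
lemma Maclaurin_bigo:
  fixes D :: "nat \<Rightarrow> real \<Rightarrow> real"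
  assumes D: "\<And>m x. (D m has_real_derivative D (Suc m) x) (at x)"
  shows "(\<lambda>x. D 0 x - (\<Sum>m<n. D m 0 / fact m * x ^ m)) \<in> O[nhds 0](\<lambda>x. x ^ n)"
proof -
  have "continuous_on {-1..1} (D n)"
    by (rule DERIV_continuous_on) (rule DERIV_subset[OF D], simp)
  then have "bounded (D n ` {-1..1})"
    by (intro compact_imp_bounded compact_continuous_image) auto
  then obtain B where B: "\<And>t. t \<in> {-1..1} \<Longrightarrow> \<bar>D n t\<bar> \<le> B"
    by (metis bounded_iff image_eqI real_norm_def)
  have "eventually (\<lambda>x::real. x \<in> {-1<..<1}) (nhds 0)"
    by (intro eventually_nhds_in_open) auto
  then have "eventually (\<lambda>x. norm (D 0 x - (\<Sum>m<n. D m 0 / fact m * x ^ m))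
      \<le> B / fact n * norm (x ^ n)) (nhds 0)"
  proof eventually_elim
    case (elim x)
    obtain t where t: "\<bar>t\<bar> \<le> \<bar>x\<bar>"
      and eq: "D 0 x = (\<Sum>m<n. D m 0 / fact m * x ^ m) + D n t / fact n * x ^ n"
      using Maclaurin_all_le[of D "D 0" x n] D by blast
    have "\<bar>D n t\<bar> \<le> B" by (rule B) (use t elim in auto)
    then have "\<bar>D n t / fact n * x ^ n\<bar> \<le> B / fact n * \<bar>x ^ n\<bar>"
      unfolding abs_mult by (intro mult_right_mono) (auto simp: divide_right_mono)
    then show ?case using eq by simp
  qed
  then show ?thesis by (rule bigoI)
qed

lemma exp_expansion:
  fixes c :: real
  shows "(\<lambda>x. exp (c * x) - (1 + c * x + c\<^sup>2 / 2 * x\<^sup>2)) \<in> O[at_right 0](\<lambda>x. x ^ 3)"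
proof -
  have "((\<lambda>x. c ^ m * exp (c * x)) has_real_derivative c ^ Suc m * exp (c * x)) (at x)" for m x
    by (auto intro!: derivative_eq_intros)
  from Maclaurin_bigo[of "\<lambda>m x. c ^ m * exp (c * x)", OF this, of 3]
  have "(\<lambda>x. exp (c * x) - (1 + c * x + c\<^sup>2 / 2 * x\<^sup>2)) \<in> O[nhds 0](\<lambda>x. x ^ 3)"
    by (simp add: eval_nat_numeral)
  then show ?thesis
    by (rule landau_o.big.filter_mono[rotated]) (rule at_within_le_nhds)
qed

section \<open>Integrals with an algebraic singularity at 0\<close>

text \<open>
  The power may be unbounded at 0, but it is absolutely integrable, and a bounded measurable factor
  preserves this.
\<close>
lemma powr_times_continuous_integrable:
  fixes f :: "real \<Rightarrow> real"
  assumes p: "p > -1" and f: "continuous_on {0..b} f"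
  shows "(\<lambda>t. t powr p * f t) integrable_on {0..b}"
proof (cases "b \<ge> 0")
  case True
  have 1: "(\<lambda>t. t powr p) absolutely_integrable_on {0..b}"
  proof (rule nonnegative_absolutely_integrable_1)
    show "(\<lambda>t. t powr p) integrable_on {0..b}"
      using has_integral_powr_from_0[OF p True] by (rule has_integral_integrable)
  qed simp
  have 2: "bounded (f ` {0..b})"
    by (intro compact_imp_bounded compact_continuous_image f compact_Icc)
  have 3: "{0..b} \<in> sets lebesgue" by simp
  have "f \<in> borel_measurable (lebesgue_on {0..b})"
    by (rule continuous_imp_measurable_on_sets_lebesgue[OF f 3])
  from absolutely_integrable_bounded_measurable_product_real[OF this 3 2 1]
  have "(\<lambda>t. f t * t powr p) integrable_on {0..b}"
    by (rule set_lebesgue_integral_eq_integral(1))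
  then show ?thesis by (simp only: mult.commute)
qed (simp add: integrable_on_empty)

text \<open>
  Continuity is asked for at the endpoint \<^term>\<open>x\<close> only, so that an integrand with an
  integrable singularity at 0 is admitted.
\<close>
lemma integral_from_0_deriv:
  fixes F :: "real \<Rightarrow> real"
  assumes int: "F integrable_on {0..x + 1}" and x: "x > 0" and cont: "isCont F x"
  shows "((\<lambda>x. integral {0..x} F) has_real_derivative F x) (at x)"
proof -
  have "((\<lambda>x. integral {0..x} F) has_vector_derivative F x) (at x within ({0..x + 1} - {}))"
  proof (rule integral_has_vector_derivative_continuous_at[OF int])
    show "x \<in> {0..x + 1} - {}" using x by simp
    show "continuous (at x within ({0..x + 1} - {})) F"
      using cont by (rule continuous_at_imp_continuous_at_within)
  qed (rule finite.emptyI)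
  moreover have "at x within ({0..x + 1} - {}) = at x"
  proof -
    have "x \<in> interior {0..x + 1}" using x by simp
    then show ?thesis unfolding Diff_empty by (rule at_within_interior)
  qed
  ultimately show ?thesis by (simp only: has_real_derivative_iff_has_vector_derivative)
qed

text \<open>
  Near 0 the integrand is bounded by a multiple of \<^term>\<open>t powr (p + n)\<close>, whose integral is
  \<^term>\<open>x powr (p + n + 1) / (p + n + 1)\<close>.
\<close>
lemma integral_powr_bigo:
  fixes r :: "real \<Rightarrow> real"
  assumes p: "p > -1" and int: "\<And>b. (\<lambda>t. t powr p * r t) integrable_on {0..b}"
    and r: "r \<in> O[at_right 0](\<lambda>x. x ^ n)"
  shows "(\<lambda>x. integral {0..x} (\<lambda>t. t powr p * r t) / x powr (p + 1)) \<in> O[at_right 0](\<lambda>x. x ^ n)"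
proof -
  obtain C where "eventually (\<lambda>x. norm (r x) \<le> C * norm (x ^ n)) (at_right 0)"
    using landau_o.bigE[OF r] by blast
  then obtain d where d: "d > 0" "\<And>x. 0 < x \<Longrightarrow> x < d \<Longrightarrow> \<bar>r x\<bar> \<le> C * \<bar>x ^ n\<bar>"
    unfolding eventually_at_right_field by auto
  have pn: "p + real n > -1" using p by simp
  have "eventually (\<lambda>x. x \<in> {0<..<d}) (at_right 0)"
    by (rule eventually_at_right_real) (rule d)
  then have "eventually (\<lambda>x. norm (integral {0..x} (\<lambda>t. t powr p * r t) / x powr (p + 1))
      \<le> C / (p + n + 1) * norm (x ^ n)) (at_right 0)"
  proof eventually_elim
    case (elim x)
    then have x: "0 < x" "x < d" by auto
    have I: "((\<lambda>t. C * t powr (p + n)) has_integral C * (x powr (p + n + 1) / (p + n + 1))) {0..x}"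
      by (intro has_integral_mult_right has_integral_powr_from_0 pn) (use x in auto)
    have "norm (integral {0..x} (\<lambda>t. t powr p * r t)) \<le> integral {0..x} (\<lambda>t. C * t powr (p + n))"
    proof (rule integral_norm_bound_integral[OF int])
      fix t assume t: "t \<in> {0..x}"
      show "norm (t powr p * r t) \<le> C * t powr (p + n)"
      proof (cases "t = 0")
        case False
        with t x have "0 < t" "t < d" by auto
        then show ?thesis using mult_left_mono[OF d(2)[of t], of "t powr p"]
          by (simp add: abs_mult powr_add powr_realpow ac_simps)
      qed simp
    qed (use I in blast)
    also have "\<dots> = C / (p + n + 1) * x ^ n * x powr (p + 1)"
      using integral_unique[OF I] x by (simp add: powr_add powr_realpow)
    finally show ?case using x by (simp add: divide_le_eq)
  qed
  then show ?thesis by (rule bigoI)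
qed

text \<open>
  A Taylor polynomial may be integrated against \<^term>\<open>t powr q\<close> term by term; this is where the
  denominators \<^term>\<open>q + 1\<close>, \<^term>\<open>q + 2\<close> and \<^term>\<open>q + 3\<close> of the small-argument expansion come from.
\<close>
lemma integral_powr_expansion:
  fixes f :: "real \<Rightarrow> real"
  assumes q: "q > -1" and f: "continuous_on {0..} f"
    and exp: "(\<lambda>x. f x - (c0 + c1 * x + c2 * x\<^sup>2)) \<in> O[at_right 0](\<lambda>x. x ^ 3)"
  shows "(\<lambda>x. integral {0..x} (\<lambda>t. t powr q * f t) / x powr (q + 1)
      - (c0 / (q + 1) + c1 / (q + 2) * x + c2 / (q + 3) * x\<^sup>2)) \<in> O[at_right 0](\<lambda>x. x ^ 3)"
proof -
  define r where "r x = f x - (c0 + c1 * x + c2 * x\<^sup>2)" for x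
  have contr: "continuous_on {0..b} r" for b
    unfolding r_def by (intro continuous_intros continuous_on_subset[OF f]) auto
  have intr: "(\<lambda>t. t powr q * r t) integrable_on {0..b}" for b
    by (rule powr_times_continuous_integrable[OF q contr])
  have "(\<lambda>x. integral {0..x} (\<lambda>t. t powr q * r t) / x powr (q + 1)) \<in> O[at_right 0](\<lambda>x. x ^ 3)"
    using exp by (intro integral_powr_bigo q intr) (simp add: r_def[abs_def])
  moreover have "eventually (\<lambda>x. integral {0..x} (\<lambda>t. t powr q * r t) / x powr (q + 1)
      = integral {0..x} (\<lambda>t. t powr q * f t) / x powr (q + 1)
      - (c0 / (q + 1) + c1 / (q + 2) * x + c2 / (q + 3) * x\<^sup>2)) (at_right 0)"
    using eventually_at_right_less[of 0]
  proof eventually_elim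
    case (elim x)
    have I: "((\<lambda>t. t powr q * r t) has_integral integral {0..x} (\<lambda>t. t powr q * r t)) {0..x}"
      using intr by (rule integrable_integral)
    have P: "((\<lambda>t. c0 * t powr q + c1 * t powr (q + 1) + c2 * t powr (q + 2)) has_integral
        c0 * (x powr (q + 1) / (q + 1)) + c1 * (x powr (q + 1 + 1) / (q + 1 + 1))
        + c2 * (x powr (q + 2 + 1) / (q + 2 + 1))) {0..x}"
      by (intro has_integral_add has_integral_mult_right has_integral_powr_from_0) (use q elim in auto)
    have "t powr q * r t + (c0 * t powr q + c1 * t powr (q + 1) + c2 * t powr (q + 2)) = t powr q * f t"
      if "t \<in> {0..x}" for t
    \<comment> \<open>At 0 both sides vanish because \<^term>\<open>0 powr q = (0::real)\<close>.\<close>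
    proof (cases "t = 0")
      case False
      then have "t > 0" using that by auto
      then have "t powr (q + 1) = t powr q * t" "t powr (q + 2) = t powr q * t\<^sup>2"
        by (simp_all add: powr_add)
      then show ?thesis by (simp add: r_def algebra_simps)
    qed simp
    then have "integral {0..x} (\<lambda>t. t powr q * f t) = integral {0..x} (\<lambda>t. t powr q * r t)
        + (c0 * (x powr (q + 1) / (q + 1)) + c1 * (x powr (q + 1 + 1) / (q + 1 + 1))
        + c2 * (x powr (q + 2 + 1) / (q + 2 + 1)))"
      using has_integral_add[OF I P] by (intro integral_unique) (rule has_integral_eq)
    moreover have "x powr (q + 1 + 1) = x powr (q + 1) * x" "x powr (q + 2 + 1) = x powr (q + 1) * x\<^sup>2"
      using elim by (simp_all add: powr_add power2_eq_square power3_eq_cube)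
    ultimately show ?case using elim by (simp add: add_divide_distrib add_ac)
  qed
  ultimately show ?thesis by (rule landau_o.big.in_cong[THEN iffD1, rotated])
qed

section \<open>Damped differential equations at infinity\<close>

text \<open>
  Damping makes the error follow the size of the forcing term. The proof is an energy estimate:
  \<^term>\<open>2 * e x * g x \<le> c * (e x)\<^sup>2 + (g x)\<^sup>2 / c\<close> absorbs the mixed term of the derivative
  of \<^term>\<open>(e x)\<^sup>2\<close> into half of the damping. Hence, for a large constant \<^term>\<open>L\<close>,
  \<^term>\<open>exp (c * x) * ((e x)\<^sup>2 - L / x ^ 4)\<close> is eventually nonincreasing, and it stays
  nonpositive once it is so. The estimate is
  uniform in \<^term>\<open>p\<close>, which may therefore involve the unknown solution itself.
\<close>
lemma damped_ode_bigo:
  fixes e g p :: "real \<Rightarrow> real"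
  assumes ode: "eventually (\<lambda>x. (e has_real_derivative g x - p x * e x) (at x)) at_top"
    and damp: "eventually (\<lambda>x. p x \<ge> c) at_top" and c: "c > 0"
    and g: "g \<in> O(\<lambda>x. 1 / x\<^sup>2)"
  shows "e \<in> O(\<lambda>x. 1 / x\<^sup>2)"
proof -
  obtain K where K: "K > 0" "eventually (\<lambda>x. \<bar>g x\<bar> \<le> K / x\<^sup>2) at_top"
    using landau_o.bigE[OF g] by (auto simp: eventually_mono)
  have "eventually (\<lambda>x. (e has_real_derivative g x - p x * e x) (at x) \<and> p x \<ge> c
      \<and> \<bar>g x\<bar> \<le> K / x\<^sup>2 \<and> x \<ge> 8 / c) at_top"
    using ode damp K(2) eventually_ge_at_top[of "8 / c"] by eventually_elim auto
  then obtain X where "\<forall>x\<ge>X. (e has_real_derivative g x - p x * e x) (at x) \<and> p x \<ge> c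
      \<and> \<bar>g x\<bar> \<le> K / x\<^sup>2 \<and> x \<ge> 8 / c"
    unfolding eventually_at_top_linorder by blast
  then have X: "(e has_real_derivative g x - p x * e x) (at x)" "p x \<ge> c" "\<bar>g x\<bar> \<le> K / x\<^sup>2" "x \<ge> 8 / c"
    if "x \<ge> X" for x using that by auto
  have pos: "x > 0" if "x \<ge> X" for x
    using X(4)[OF that] c by (smt (verit) divide_pos_pos)
  \<comment> \<open>The first entry makes the function below decrease, the second makes it start at or below 0.\<close>
  define L where "L = max (2 * K\<^sup>2 / c\<^sup>2) ((e X)\<^sup>2 * X ^ 4)"
  define Z where "Z x = exp (c * x) * ((e x)\<^sup>2 - L / x ^ 4)" for x
  have mono: "Z x \<le> Z X" if "x \<ge> X" for x
  proof (rule DERIV_nonpos_imp_nonincreasing[OF that])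
    fix y assume y: "X \<le> y" "y \<le> x"
    have y0: "y > 0" by (rule pos) fact
    have d: "(Z has_real_derivative exp (c * y) *
        (c * ((e y)\<^sup>2 - L / y ^ 4) + 2 * e y * (g y - p y * e y) + 4 * L / y ^ 5)) (at y)"
      unfolding Z_def[abs_def] using y0
      by (auto intro!: derivative_eq_intros X(1)[OF y(1)] simp: field_simps power2_eq_square eval_nat_numeral)
    have "c * (e y)\<^sup>2 \<le> p y * (e y)\<^sup>2" using X(2)[OF y(1)] by (intro mult_right_mono) auto
    moreover have "2 * e y * g y \<le> c * (e y)\<^sup>2 + (g y)\<^sup>2 / c"
    proof -
      have "0 \<le> (c * e y - g y)\<^sup>2 / c" using c by simp
      then show ?thesis using c by (simp add: power2_eq_square field_simps)
    qed
    moreover have "(g y)\<^sup>2 / c \<le> c * L / 2 / y ^ 4"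
    proof -
      have "\<bar>g y\<bar>\<^sup>2 \<le> (K / y\<^sup>2)\<^sup>2" by (rule power_mono[OF X(3)[OF y(1)]]) simp
      then have "(g y)\<^sup>2 / c \<le> (K / y\<^sup>2)\<^sup>2 / c" using c by (simp add: divide_right_mono)
      also have "\<dots> = c / 2 * (2 * K\<^sup>2 / c\<^sup>2) / y ^ 4"
        using c y0 by (simp add: field_simps power2_eq_square eval_nat_numeral)
      also have "\<dots> \<le> c / 2 * L / y ^ 4"
        using c y0 unfolding L_def by (intro divide_right_mono mult_left_mono) auto
      finally show ?thesis by simp
    qed
    \<comment> \<open>The term from differentiating the barrier is of lower order;
      \<^term>\<open>y \<ge> 8 / c\<close> makes it at most half of what damping contributes there.\<close>
    moreover have "4 * L / y ^ 5 \<le> c * L / 2 / y ^ 4"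
    proof -
      have "8 \<le> c * y" using X(4)[OF y(1)] c by (simp add: field_simps)
      moreover have "L \<ge> 0" unfolding L_def by (simp add: le_max_iff_disj)
      ultimately have "8 * L \<le> c * y * L" by (rule mult_right_mono)
      then show ?thesis using y0 by (simp add: field_simps eval_nat_numeral)
    qed
    ultimately have "c * ((e y)\<^sup>2 - L / y ^ 4) + 2 * e y * (g y - p y * e y) + 4 * L / y ^ 5 \<le> 0"
      by (simp add: algebra_simps power2_eq_square)
    then have "exp (c * y) *
        (c * ((e y)\<^sup>2 - L / y ^ 4) + 2 * e y * (g y - p y * e y) + 4 * L / y ^ 5) \<le> 0"
      by (simp add: mult_nonneg_nonpos)
    with d show "\<exists>d. (Z has_real_derivative d) (at y) \<and> d \<le> 0" by blast
  qed
  have "Z X \<le> 0"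
  proof -
    have "(e X)\<^sup>2 \<le> L / X ^ 4" using pos[of X] unfolding L_def by (simp add: field_simps)
    then show ?thesis unfolding Z_def by (simp add: mult_nonneg_nonpos)
  qed
  then have bound: "\<bar>e x\<bar> \<le> sqrt L * \<bar>1 / x\<^sup>2\<bar>" if "x \<ge> X" for x
  proof -
    have "Z x \<le> 0" using mono[OF that] \<open>Z X \<le> 0\<close> by linarith
    then have "(e x)\<^sup>2 \<le> L / x ^ 4" unfolding Z_def by (simp add: mult_le_0_iff)
    then have "\<bar>e x\<bar> \<le> sqrt (L / x ^ 4)" by (simp add: real_le_rsqrt)
    also have "x ^ 4 = (x\<^sup>2)\<^sup>2" by simp
    also have "sqrt (L / (x\<^sup>2)\<^sup>2) = sqrt L * \<bar>1 / x\<^sup>2\<bar>" unfolding real_sqrt_divide real_sqrt_abs by simp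
    finally show ?thesis .
  qed
  show ?thesis
    by (rule bigoI[where c = "sqrt L"])
       (use bound in \<open>auto simp: eventually_at_top_linorder intro!: exI[of _ X]\<close>)
qed

text \<open>
  The approximation \<^term>\<open>1 + m / x\<close> solves the equation up to \<^term>\<open>(m\<^sup>2 + m) / x\<^sup>2\<close>.
  Positivity singles out the right solutions: it keeps them on the side of the attracting root 1 of
  \<^term>\<open>1 - u\<^sup>2 = (0::real)\<close> and gives the damping.
\<close>
lemma riccati_expansion:
  fixes u :: "real \<Rightarrow> real"
  assumes ode: "\<And>x. x > 0 \<Longrightarrow> (u has_real_derivative 1 + 2 * m / x * u x - (u x)\<^sup>2) (at x)"
    and pos: "\<And>x. x > 0 \<Longrightarrow> u x > 0"
  shows "(\<lambda>x. u x - (1 + m / x)) \<in> O(\<lambda>x. 1 / x\<^sup>2)"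
proof (rule damped_ode_bigo)
  \<comment> \<open>A difference of squares factors, so the error obeys a linear equation with damping
    \<^term>\<open>u x + (1 + m / x) - 2 * m / x\<close>.\<close>
  show "eventually (\<lambda>x. ((\<lambda>x. u x - (1 + m / x)) has_real_derivative
      (m\<^sup>2 + m) * (1 / x\<^sup>2) - (u x + (1 - m / x)) * (u x - (1 + m / x))) (at x)) at_top"
    using eventually_gt_at_top[of 0]
  proof eventually_elim
    case (elim x)
    show ?case using elim
      by (auto intro!: derivative_eq_intros ode simp: field_simps power2_eq_square)
  qed
  have "((\<lambda>x. 1 - m / x) \<longlongrightarrow> 1 - 0) at_top"
    by (intro tendsto_diff tendsto_const real_tendsto_divide_at_top[OF tendsto_const] filterlim_ident)
  then have "eventually (\<lambda>x. 1 - m / x > 1 / 2) at_top"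
    by (rule order_tendstoD) simp
  with eventually_gt_at_top[of 0] show "eventually (\<lambda>x. u x + (1 - m / x) \<ge> 1 / 2) at_top"
    by eventually_elim (use pos in \<open>smt (verit)\<close>)
  show "(\<lambda>x. (m\<^sup>2 + m) * (1 / x\<^sup>2)) \<in> O(\<lambda>x. 1 / x\<^sup>2)"
    by (intro bigo_cmult) simp
qed auto

text \<open>
  To leading order the equation is \<open>R' = 1 - a * R\<close>, hence the limit \<^term>\<open>1 / a\<close>.
\<close>
lemma linear_ode_expansion:
  fixes u R :: "real \<Rightarrow> real"
  assumes ode: "\<And>x. x > 0 \<Longrightarrow>
      (R has_real_derivative u x - (u x - (1 - a) + b / x) * R x) (at x)"
    and u: "(\<lambda>x. u x - (1 + m / x)) \<in> O(\<lambda>x. 1 / x\<^sup>2)" and a: "a > 0"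
  shows "(\<lambda>x. R x - (1 / a + (a * m - m - b) / (a\<^sup>2 * x))) \<in> O(\<lambda>x. 1 / x\<^sup>2)"
proof -
  \<comment> \<open>The coefficient of \<^term>\<open>1 / x\<close> that cancels the terms of that order in the residual;
    the residual is then the function \<open>g\<close> below.\<close>
  define k where "k = (a * m - m - b) / a\<^sup>2"
  define w where "w x = u x - (1 + m / x)" for x
  define g where "g x = (1 - 1 / a) * w x - k * (1 / x * w x) - (k * (m + b) - k) * (1 / x\<^sup>2)" for x
  have lim0: "((\<lambda>x. c / x) \<longlongrightarrow> 0) at_top" for c :: real
    by (intro real_tendsto_divide_at_top[OF tendsto_const] filterlim_ident)
  have w: "w \<in> O(\<lambda>x. 1 / x\<^sup>2)" using u by (simp add: w_def[abs_def])
  have wlim: "(w \<longlongrightarrow> 0) at_top"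
  proof -
    have "((\<lambda>x::real. 1 / x\<^sup>2) \<longlongrightarrow> 0) at_top" 
      using tendsto_mult[OF lim0[of 1] lim0[of 1]] by (simp add: power2_eq_square)
    then have "((\<lambda>x::real. C * norm (1 / x\<^sup>2)) \<longlongrightarrow> 0) at_top" for C
      by (intro tendsto_mult_right_zero tendsto_norm_zero)
    moreover obtain C where "eventually (\<lambda>x. norm (w x) \<le> C * norm (1 / x\<^sup>2)) at_top"
      using landau_o.bigE[OF w] by blast
    ultimately show ?thesis by (rule Lim_null_comparison[rotated])
  qed
  have "(\<lambda>x. R x - (1 / a + k / x)) \<in> O(\<lambda>x. 1 / x\<^sup>2)"
  proof (rule damped_ode_bigo)
    show "eventually (\<lambda>x. ((\<lambda>x. R x - (1 / a + k / x)) has_real_derivative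
        g x - (u x - (1 - a) + b / x) * (R x - (1 / a + k / x))) (at x)) at_top"
      using eventually_gt_at_top[of 0]
    proof eventually_elim
      case (elim x)
      have ux: "u x = w x + 1 + m / x" by (simp add: w_def)
      have "u x - (u x - (1 - a) + b / x) * R x + k / x\<^sup>2
          = g x - (u x - (1 - a) + b / x) * (R x - (1 / a + k / x))"
        unfolding g_def ux k_def using elim a by (simp add: field_simps power2_eq_square)
      moreover have "((\<lambda>x. R x - (1 / a + k / x)) has_real_derivative 
          u x - (u x - (1 - a) + b / x) * R x + k / x\<^sup>2) (at x)"
        using elim by (auto intro!: derivative_eq_intros ode simp: power2_eq_square)
      ultimately show ?case by simp
    qed
    have "((\<lambda>x. w x + m / x + a + b / x) \<longlongrightarrow> 0 + 0 + a + 0) at_top"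
      by (intro tendsto_intros wlim lim0)
    then have "eventually (\<lambda>x. w x + m / x + a + b / x > a / 2) at_top"
      by (rule order_tendstoD) (use a in simp)
    then show "eventually (\<lambda>x. u x - (1 - a) + b / x \<ge> a / 2) at_top"
      by eventually_elim (simp add: w_def)
    have "(\<lambda>x. 1 / x * w x) \<in> O(\<lambda>x. 1 * (1 / x\<^sup>2))"
      by (intro landau_o.big.mult w bigoI_tendsto[where c = 0]) (use lim0[of 1] in auto)
    then have 2: "(\<lambda>x. k * (1 / x * w x)) \<in> O(\<lambda>x. 1 / x\<^sup>2)"
      by (intro bigo_cmult) simp
    have 1: "(\<lambda>x. (1 - 1 / a) * w x) \<in> O(\<lambda>x. 1 / x\<^sup>2)"
      using w by (rule bigo_cmult)
    have 3: "(\<lambda>x. (k * (m + b) - k) * (1 / x\<^sup>2)) \<in> O(\<lambda>x. 1 / x\<^sup>2)"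
      by (intro bigo_cmult) simp
    show "g \<in> O(\<lambda>x. 1 / x\<^sup>2)" unfolding g_def[abs_def]
      by (intro sum_in_bigo 1 2 3)
  qed (use a in auto)
  then show ?thesis by (simp add: k_def)
qed

section \<open>The Bessel--Clifford function\<close>

text \<open>
  Up to a power of its argument, the modified Bessel function at
  \<^term>\<open>x\<close> is this entire function at \<^term>\<open>x\<^sup>2 / 4\<close>. The reciprocal Gamma function keeps the
  differentiation rule and the recurrence below valid for every real order.
\<close>
definition bessel_clifford :: "real \<Rightarrow> real \<Rightarrow> real" where
  "bessel_clifford \<nu> z = (\<Sum>k. rGamma (real k + \<nu> + 1) / fact k * z ^ k)"

lemma summable_bessel_clifford:
  "summable (\<lambda>k. rGamma (real k + \<nu> + 1) / fact k * z ^ k)" for \<nu> z :: real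
proof (rule summable_ratio_test)
  \<comment> \<open>From here on the ratio of consecutive terms is at most one half.\<close>
  define N where "N = nat \<lceil>\<bar>\<nu>\<bar> + 2 * \<bar>z\<bar> + 1\<rceil>"
  fix k :: nat assume k: "N \<le> k"
  have "\<bar>\<nu>\<bar> + 2 * \<bar>z\<bar> + 1 \<le> real N" unfolding N_def by linarith
  then have *: "2 * \<bar>z\<bar> \<le> real k + \<nu> + 1" "0 < real k + \<nu> + 1" using k by linarith+
  have rec: "rGamma (real k + \<nu> + 1) = (real k + \<nu> + 1) * rGamma (real (Suc k) + \<nu> + 1)"
    using rGamma_plus1[of "real k + \<nu> + 1"] by (simp add: algebra_simps)
  have "2 * \<bar>z\<bar> * \<bar>rGamma (real (Suc k) + \<nu> + 1)\<bar> \<le> \<bar>rGamma (real k + \<nu> + 1)\<bar>"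
    unfolding rec abs_mult using * by (intro mult_right_mono) auto
  then have "2 * \<bar>z\<bar> * \<bar>rGamma (real (Suc k) + \<nu> + 1)\<bar> \<le> real (Suc k) * \<bar>rGamma (real k + \<nu> + 1)\<bar>"
    by (rule order_trans) (simp add: mult_le_cancel_right1)
  then have "(2 * \<bar>z\<bar> * \<bar>rGamma (real (Suc k) + \<nu> + 1)\<bar>) * \<bar>z\<bar> ^ k \<le> (real (Suc k) * \<bar>rGamma (real k + \<nu> + 1)\<bar>) * \<bar>z\<bar> ^ k"
    by (rule mult_right_mono) simp
  then show "norm (rGamma (real (Suc k) + \<nu> + 1) / fact (Suc k) * z ^ Suc k)
      \<le> 1 / 2 * norm (rGamma (real k + \<nu> + 1) / fact k * z ^ k)"
    by (simp add: abs_mult power_abs field_simps del: of_nat_Suc)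
qed simp

text \<open>
  Differentiating \<^term>\<open>z ^ k / fact k\<close> shifts the index by one, and the reciprocal Gamma factor turns
  this into a shift of the order.
\<close>
lemma bessel_clifford_deriv:
  "(bessel_clifford \<nu> has_real_derivative bessel_clifford (\<nu> + 1) z) (at z)"
proof -
  let ?c = "\<lambda>k. rGamma (real k + \<nu> + 1) / fact k"
  have "diffs ?c k = rGamma (real k + (\<nu> + 1) + 1) / fact k" for k
    by (simp add: diffs_def field_simps del: of_nat_Suc) (simp add: add_ac)
  moreover have "((\<lambda>z. \<Sum>k. ?c k * z ^ k) has_real_derivative (\<Sum>k. diffs ?c k * z ^ k)) (at z)"
    by (rule termdiffs_strong_converges_everywhere) (rule summable_bessel_clifford)
  ultimately show ?thesis unfolding bessel_clifford_def[abs_def] by simp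
qed

lemma bessel_clifford_0: "bessel_clifford \<nu> 0 = rGamma (\<nu> + 1)"
  unfolding bessel_clifford_def by (subst powser_zero) simp

text \<open>
  The recurrence \<^term>\<open>s * rGamma (s + 1) = rGamma s\<close> at \<^term>\<open>s = real k + \<nu> + 1\<close>, applied to
  each coefficient. Together with the rule for the derivative it expresses all derivatives through two consecutive orders.
\<close>
lemma bessel_clifford_recurrence:
  "bessel_clifford \<nu> z = (\<nu> + 1) * bessel_clifford (\<nu> + 1) z + z * bessel_clifford (\<nu> + 2) z"
proof -
  let ?a = "\<lambda>\<nu> k. rGamma (real k + \<nu> + 1) / fact k * z ^ k"
  let ?b = "\<lambda>k. real k * rGamma (real k + \<nu> + 2) / fact k * z ^ k"
  have s: "?b sums (z * bessel_clifford (\<nu> + 2) z)"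
  proof -
    have "(\<lambda>k. z * ?a (\<nu> + 2) k) sums (z * bessel_clifford (\<nu> + 2) z)"
      unfolding bessel_clifford_def by (intro sums_mult summable_sums summable_bessel_clifford)
    moreover have "(\<lambda>k. z * ?a (\<nu> + 2) k) = (\<lambda>k. ?b (Suc k))"
      by (simp add: fun_eq_iff field_simps del: of_nat_Suc) (simp add: add_ac)
    ultimately have "(\<lambda>k. ?b (Suc k)) sums (z * bessel_clifford (\<nu> + 2) z)" by metis
    then show ?thesis by (subst (asm) sums_Suc_iff) simp
  qed
  have t: "(\<lambda>k. (\<nu> + 1) * ?a (\<nu> + 1) k) sums ((\<nu> + 1) * bessel_clifford (\<nu> + 1) z)"
    unfolding bessel_clifford_def by (intro sums_mult summable_sums summable_bessel_clifford)
  have "(\<nu> + 1) * ?a (\<nu> + 1) k + ?b k = ?a \<nu> k" for k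
  proof -
    have shift: "real k + (\<nu> + 1) + 1 = real k + \<nu> + 2" by simp
    have rec: "rGamma (real k + \<nu> + 1) = (real k + \<nu> + 1) * rGamma (real k + \<nu> + 2)"
      using rGamma_plus1[of "real k + \<nu> + 1"] by (simp add: add.assoc)
    show ?thesis unfolding shift rec by (simp add: add_divide_distrib distrib_right)
  qed
  then show ?thesis
    using sums_add[OF t s] unfolding bessel_clifford_def by (simp add: sums_iff)
qed

lemma bessel_clifford_pos:
  assumes "\<nu> > -1" "z \<ge> 0"
  shows "bessel_clifford \<nu> z > 0"
proof -
  have "rGamma (real k + \<nu> + 1) > 0" for k
    using assms by (simp add: rGamma_inverse_Gamma)
  from this this[of 0] show ?thesis unfolding bessel_clifford_def using assms
    by (intro suminf_pos2[where i = 0] summable_bessel_clifford) (auto simp: less_imp_le)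
qed

lemma besselI_eq_bessel_clifford:
  assumes "x > 0"
  shows "besselI \<nu> x = (x / 2) powr \<nu> * bessel_clifford \<nu> (x\<^sup>2 / 4)"
proof -
  have "(x / 2) powr (2 * real k + \<nu>) = (x / 2) powr \<nu> * (x\<^sup>2 / 4) ^ k" for k
  proof -
    have "(x / 2) powr (2 * real k) = (x / 2) ^ (2 * k)"
      using assms powr_realpow[of "x / 2" "2 * k"] by simp
    then show ?thesis by (simp add: powr_add power_mult power_divide)
  qed
  then have "besselI \<nu> x = (\<Sum>k. (x / 2) powr \<nu> * (rGamma (real k + \<nu> + 1) / fact k * (x\<^sup>2 / 4) ^ k))"
    unfolding besselI_def by (simp only: rGamma_inverse_Gamma divide_inverse inverse_mult_distrib ac_simps)
  also have "\<dots> = (x / 2) powr \<nu> * bessel_clifford \<nu> (x\<^sup>2 / 4)"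
    unfolding bessel_clifford_def by (rule suminf_mult) (rule summable_bessel_clifford)
  finally show ?thesis .
qed

lemma bessel_clifford_square_deriv:
  "((\<lambda>x. bessel_clifford \<nu> (x\<^sup>2 / 4)) has_real_derivative x / 2 * bessel_clifford (\<nu> + 1) (x\<^sup>2 / 4)) (at x)"
proof -
  have "((\<lambda>x. x\<^sup>2 / 4) has_real_derivative x / 2) (at x)"
    by (auto intro!: derivative_eq_intros)
  from DERIV_chain2[OF bessel_clifford_deriv this] show ?thesis by (simp add: mult.commute)
qed

lemma continuous_on_bessel_clifford_square:
  "continuous_on S (\<lambda>x. bessel_clifford \<nu> (x\<^sup>2 / 4))"
  by (rule DERIV_continuous_on) (rule DERIV_subset[OF bessel_clifford_square_deriv], simp)

lemma bessel_clifford_square_expansion: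
  "(\<lambda>x. bessel_clifford \<nu> (x\<^sup>2 / 4) - (rGamma (\<nu> + 1) + rGamma (\<nu> + 2) / 4 * x\<^sup>2))
     \<in> O[at_right 0](\<lambda>x. x ^ 3)"
proof -
  have "(bessel_clifford (\<nu> + real m) has_real_derivative bessel_clifford (\<nu> + real (Suc m)) z) (at z)"
    for m z using bessel_clifford_deriv[of "\<nu> + real m" z] by (simp add: add_ac)
  from Maclaurin_bigo[of "\<lambda>m. bessel_clifford (\<nu> + real m)", OF this, of 2]
  have "(\<lambda>z. bessel_clifford \<nu> z - (rGamma (\<nu> + 1) + rGamma (\<nu> + 2) * z)) \<in> O[nhds 0](\<lambda>z. z\<^sup>2)"
    by (simp add: numeral_2_eq_2 bessel_clifford_0 add_ac)
  moreover have "((\<lambda>x::real. x\<^sup>2 / 4) \<longlongrightarrow> 0) (at_right 0)"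
    by (auto intro!: tendsto_eq_intros)
  ultimately have "(\<lambda>x. bessel_clifford \<nu> (x\<^sup>2 / 4) - (rGamma (\<nu> + 1) + rGamma (\<nu> + 2) * (x\<^sup>2 / 4)))
      \<in> O[at_right 0](\<lambda>x. (x\<^sup>2 / 4)\<^sup>2)"
    by (rule landau_o.big.compose)
  also have "(\<lambda>x::real. (x\<^sup>2 / 4)\<^sup>2) \<in> O[at_right 0](\<lambda>x. x ^ 3)"
  proof (rule bigoI_tendsto)
    have "((\<lambda>x::real. x / 16) \<longlongrightarrow> 0) (at_right 0)"
      by (auto intro!: tendsto_eq_intros)
    moreover have "eventually (\<lambda>x::real. x / 16 = (x\<^sup>2 / 4)\<^sup>2 / x ^ 3) (at_right 0)"
      using eventually_at_right_less[of 0]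
      by eventually_elim (simp add: field_simps eval_nat_numeral)
    ultimately show "((\<lambda>x::real. (x\<^sup>2 / 4)\<^sup>2 / x ^ 3) \<longlongrightarrow> 0) (at_right 0)"
      by (rule Lim_transform_eventually)
    show "eventually (\<lambda>x::real. x ^ 3 \<noteq> 0) (at_right 0)"
      using eventually_at_right_less[of 0] by eventually_elim simp
  qed
  finally show ?thesis by simp
qed

section \<open>Expansions of the ratio\<close>

text \<open>
  All fractional powers combine into \<^term>\<open>t powr q\<close> inside the integral and
  \<^term>\<open>x powr (q + 1)\<close> outside. The identity of the integrands also holds at 0, where both vanish
  because a power of 0 is 0.
\<close>
lemma R_ratio_eq_bessel_clifford:
  assumes "x > 0"
  shows "R_ratio \<mu> q \<gamma> x =
    2 * (integral {0..x} (\<lambda>t. t powr q * (exp (- \<gamma> * t) * bessel_clifford \<mu> (t\<^sup>2 / 4)))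
           / x powr (q + 1) * exp (\<gamma> * x))
      / bessel_clifford (\<mu> + 1) (x\<^sup>2 / 4)"
proof -
  let ?f = "\<lambda>t. t powr q * (exp (- \<gamma> * t) * bessel_clifford \<mu> (t\<^sup>2 / 4))"
  have split: "t powr (q - \<mu>) * (t / 2) powr \<mu> = t powr q / 2 powr \<mu>" if "t > 0" for t :: real
    using that by (simp add: powr_divide powr_diff)
  have "exp (- \<gamma> * t) * t powr (q - \<mu>) * besselI \<mu> t = ?f t / 2 powr \<mu>"
    if "t \<in> {0..x}" for t
  proof (cases "t = 0")
    case False
    then have t: "t > 0" using that by auto
    have "exp (- \<gamma> * t) * t powr (q - \<mu>) * besselI \<mu> t =
        exp (- \<gamma> * t) * (t powr (q - \<mu>) * (t / 2) powr \<mu>) * bessel_clifford \<mu> (t\<^sup>2 / 4)"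
      using besselI_eq_bessel_clifford[OF t, of \<mu>] by simp
    then show ?thesis unfolding split[OF t] by simp
  qed simp
  then have num: "integral {0..x} (\<lambda>t. exp (- \<gamma> * t) * t powr (q - \<mu>) * besselI \<mu> t)
      = integral {0..x} ?f / 2 powr \<mu>"
    by (subst integral_divide[symmetric]) (rule integral_cong)
  have "x powr (q - \<mu>) * (x / 2) powr (\<mu> + 1) = x powr (q + 1) / (2 * 2 powr \<mu>)"
    using assms by (simp add: powr_divide powr_diff powr_add)
  moreover have "exp (- \<gamma> * x) = 1 / exp (\<gamma> * x)"
    by (simp add: exp_minus inverse_eq_divide)
  moreover have "exp (- \<gamma> * x) * x powr (q - \<mu>) * besselI (\<mu> + 1) x = exp (- \<gamma> * x)
      * (x powr (q - \<mu>) * (x / 2) powr (\<mu> + 1)) * bessel_clifford (\<mu> + 1) (x\<^sup>2 / 4)"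
    unfolding besselI_eq_bessel_clifford[OF assms] by (simp only: mult.assoc)
  ultimately have den: "exp (- \<gamma> * x) * x powr (q - \<mu>) * besselI (\<mu> + 1) x
      = 1 / exp (\<gamma> * x) * (x powr (q + 1) / (2 * 2 powr \<mu>)) * bessel_clifford (\<mu> + 1) (x\<^sup>2 / 4)"
    by simp
  show ?thesis unfolding R_ratio_def num den by simp
qed

text \<open>
  The numerator and the denominator are expanded separately to second order. Their leading coefficients are
  related by \<^term>\<open>rGamma (\<mu> + 1) = (\<mu> + 1) * rGamma (\<mu> + 2)\<close>, which gives the
  factor \<^term>\<open>\<mu> + 1\<close>.
\<close>
lemma R_ratio_expansion_0:
  fixes \<mu> q \<gamma> :: real
  assumes \<mu>: "\<mu> > -1" and q: "q > -1"
  shows "(\<lambda>x. R_ratio \<mu> q \<gamma> x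
          - 2 * (\<mu> + 1) / (q + 1) *
            (1 + \<gamma> * x / (q + 2)
               + (\<gamma>\<^sup>2 / ((q + 2) * (q + 3))
                  + (q + 1) / (4 * (\<mu> + 1) * (q + 3))
                  - 1 / (4 * (\<mu> + 2))) * x\<^sup>2))
       \<in> O[at_right 0](\<lambda>x. x ^ 3)"
proof -
  define h where "h \<nu> x = bessel_clifford \<nu> (x\<^sup>2 / 4)" for \<nu> x
  define M where "M x = integral {0..x} (\<lambda>t. t powr q * (exp (- \<gamma> * t) * h \<mu> t)) / x powr (q + 1)" for x
  define \<alpha> where "\<alpha> = \<gamma> / (q + 2)"
  define \<beta> where "\<beta> = \<gamma>\<^sup>2 / ((q + 2) * (q + 3)) + (q + 1) / (4 * (\<mu> + 1) * (q + 3)) - 1 / (4 * (\<mu> + 2))"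
  define k where "k = 2 * (\<mu> + 1) / (q + 1)"
  define T where "T x = k + k * \<alpha> * x + k * \<beta> * x\<^sup>2" for x
  define r where "r = rGamma (\<mu> + 2)"
  have r0: "rGamma (\<mu> + 1) = r * (\<mu> + 1)"
    using rGamma_plus1[of "\<mu> + 1"] by (simp add: r_def add.commute mult.commute)
  have r2: "rGamma (\<mu> + 3) = r / (\<mu> + 2)"
    using rGamma_plus1[of "\<mu> + 2"] \<mu> by (simp add: r_def eq_divide_eq add.commute mult.commute)
  have conth: "isCont (h \<nu>) x" for \<nu> x
    using DERIV_isCont[OF bessel_clifford_square_deriv] by (simp add: h_def[abs_def])
  have hpos: "h (\<mu> + 1) x > 0" for x
    unfolding h_def by (rule bessel_clifford_pos) (use \<mu> in auto)
  have h0: "(\<lambda>x. h \<mu> x - (r * (\<mu> + 1) + 0 * x + r / 4 * x\<^sup>2)) \<in> O[at_right 0](\<lambda>x. x ^ 3)"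
    using bessel_clifford_square_expansion[of \<mu>] by (simp add: h_def r0 r_def)
  have h1: "(\<lambda>x. h (\<mu> + 1) x - (r + 0 * x + r / (4 * (\<mu> + 2)) * x\<^sup>2)) \<in> O[at_right 0](\<lambda>x. x ^ 3)"
    using bessel_clifford_square_expansion[of "\<mu> + 1"] by (simp add: h_def r2 r_def add_ac mult_ac)
  \<comment> \<open>The integral divided by \<^term>\<open>x powr (q + 1)\<close>. Everything is a multiple of \<^term>\<open>r\<close>,
    which cancels between numerator and denominator.\<close>
  have M: "(\<lambda>x. M x - (r * (\<mu> + 1) / (q + 1) + - \<gamma> * (r * (\<mu> + 1)) / (q + 2) * x
      + (r / 4 + \<gamma>\<^sup>2 / 2 * (r * (\<mu> + 1))) / (q + 3) * x\<^sup>2)) \<in> O[at_right 0](\<lambda>x. x ^ 3)"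
    unfolding M_def
  proof (rule integral_powr_expansion[OF q])
    show "continuous_on {0..} (\<lambda>t. exp (- \<gamma> * t) * h \<mu> t)"
      unfolding h_def by (intro continuous_intros continuous_on_bessel_clifford_square)
    show "(\<lambda>x. exp (- \<gamma> * x) * h \<mu> x - (r * (\<mu> + 1) + - \<gamma> * (r * (\<mu> + 1)) * x
        + (r / 4 + \<gamma>\<^sup>2 / 2 * (r * (\<mu> + 1))) * x\<^sup>2)) \<in> O[at_right 0](\<lambda>x. x ^ 3)"
      using bigo_quadratic_mult[OF exp_expansion[of "- \<gamma>"] h0 conth] by simp
  qed
  have "isCont (\<lambda>x. exp (\<gamma> * x)) 0" by (intro continuous_intros)
  from bigo_quadratic_mult[OF M exp_expansion this]
  have ME: "(\<lambda>x. M x * exp (\<gamma> * x) -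
      (r * (\<mu> + 1) / (q + 1) * 1 + (r * (\<mu> + 1) / (q + 1) * \<gamma> + - \<gamma> * (r * (\<mu> + 1)) / (q + 2) * 1) * x
       + (r * (\<mu> + 1) / (q + 1) * (\<gamma>\<^sup>2 / 2) + - \<gamma> * (r * (\<mu> + 1)) / (q + 2) * \<gamma>
          + (r / 4 + \<gamma>\<^sup>2 / 2 * (r * (\<mu> + 1))) / (q + 3) * 1) * x\<^sup>2)) \<in> O[at_right 0](\<lambda>x. x ^ 3)" .
  \<comment> \<open>Multiplying the claimed expansion by the denominator avoids expanding a reciprocal; the two
    products have the same coefficients up to order 2.\<close>
  have TH: "(\<lambda>x. T x * h (\<mu> + 1) x - (k * r + (k * 0 + k * \<alpha> * r) * x
      + (k * (r / (4 * (\<mu> + 2))) + k * \<alpha> * 0 + k * \<beta> * r) * x\<^sup>2)) \<in> O[at_right 0](\<lambda>x. x ^ 3)"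
    by (rule bigo_quadratic_mult[OF _ h1 conth]) (simp add: T_def)
  have nz: "q + 1 \<noteq> 0" "q + 2 \<noteq> 0" "q + 3 \<noteq> 0" "\<mu> + 1 \<noteq> 0" "\<mu> + 2 \<noteq> 0" using \<mu> q by auto
  have c0: "2 * (r * (\<mu> + 1) / (q + 1) * 1) = k * r"
    by (simp add: k_def)
  have c1: "2 * (r * (\<mu> + 1) / (q + 1) * \<gamma> + - \<gamma> * (r * (\<mu> + 1)) / (q + 2) * 1) = k * 0 + k * \<alpha> * r"
    using nz by (simp add: k_def \<alpha>_def divide_simps) algebra
  have c2: "2 * (r * (\<mu> + 1) / (q + 1) * (\<gamma>\<^sup>2 / 2) + - \<gamma> * (r * (\<mu> + 1)) / (q + 2) * \<gamma>
          + (r / 4 + \<gamma>\<^sup>2 / 2 * (r * (\<mu> + 1))) / (q + 3) * 1)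
      = k * (r / (4 * (\<mu> + 2))) + k * \<alpha> * 0 + k * \<beta> * r"
    using nz by (simp add: k_def \<alpha>_def \<beta>_def divide_simps) algebra
  have "(\<lambda>x. 2 * (M x * exp (\<gamma> * x)) - (k * r + (k * 0 + k * \<alpha> * r) * x
      + (k * (r / (4 * (\<mu> + 2))) + k * \<alpha> * 0 + k * \<beta> * r) * x\<^sup>2)) \<in> O[at_right 0](\<lambda>x. x ^ 3)"
    using bigo_cmult[OF ME, of 2]
    unfolding c0[symmetric] c1[symmetric] c2[symmetric] by (simp add: algebra_simps)
  from sum_in_bigo(2)[OF this TH]
  have "(\<lambda>x. 2 * (M x * exp (\<gamma> * x)) - T x * h (\<mu> + 1) x) \<in> O[at_right 0](\<lambda>x. x ^ 3)"
    by simp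
  moreover have "(\<lambda>x. 1 / h (\<mu> + 1) x) \<in> O[at_right 0](\<lambda>_. 1)"
    by (intro bigo_1_at_right_0 continuous_intros conth) (use hpos[of 0] in simp)
  ultimately have "(\<lambda>x. (2 * (M x * exp (\<gamma> * x)) - T x * h (\<mu> + 1) x) * (1 / h (\<mu> + 1) x))
      \<in> O[at_right 0](\<lambda>x. x ^ 3 * 1)"
    by (rule landau_o.big.mult)
  moreover have "eventually (\<lambda>x. (2 * (M x * exp (\<gamma> * x)) - T x * h (\<mu> + 1) x) * (1 / h (\<mu> + 1) x)
      = R_ratio \<mu> q \<gamma> x - k * (1 + \<gamma> * x / (q + 2) + \<beta> * x\<^sup>2)) (at_right 0)"
    using eventually_at_right_less[of 0]
  proof eventually_elim
    case (elim x)
    have "R_ratio \<mu> q \<gamma> x = 2 * (M x * exp (\<gamma> * x)) / h (\<mu> + 1) x"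
      unfolding R_ratio_eq_bessel_clifford[OF elim] M_def h_def by simp
    then show ?case using hpos[of x] by (simp add: T_def \<alpha>_def diff_divide_distrib algebra_simps)
  qed
  ultimately have "(\<lambda>x. R_ratio \<mu> q \<gamma> x - k * (1 + \<gamma> * x / (q + 2) + \<beta> * x\<^sup>2))
      \<in> O[at_right 0](\<lambda>x. x ^ 3 * 1)"
    by (rule landau_o.big.in_cong[THEN iffD1, rotated])
  then show ?thesis by (simp add: k_def \<beta>_def)
qed

text \<open>
  For \<^term>\<open>x > 0\<close> this is \<^term>\<open>besselI \<mu> x / besselI (\<mu> + 1) x\<close>.
\<close>
definition bessel_quotient :: "real \<Rightarrow> real \<Rightarrow> real" where
  "bessel_quotient \<mu> x =
     2 * bessel_clifford \<mu> (x\<^sup>2 / 4) / (x * bessel_clifford (\<mu> + 1) (x\<^sup>2 / 4))"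

text \<open>
  The derivative of a quotient of consecutive orders involves the order \<^term>\<open>\<mu> + 2\<close>, which the
  recurrence eliminates; what remains is quadratic in the quotient itself.
\<close>
lemma bessel_quotient_riccati:
  assumes \<mu>: "\<mu> > -1" and x: "x > 0"
  shows "(bessel_quotient \<mu> has_real_derivative 1 + 2 * (\<mu> + 1 / 2) / x * bessel_quotient \<mu> x - (bessel_quotient \<mu> x)\<^sup>2) (at x)"
proof -
  define h where "h \<nu> x = bessel_clifford \<nu> (x\<^sup>2 / 4)" for \<nu> x
  have hd: "(h \<nu> has_real_derivative x / 2 * h (\<nu> + 1) x) (at x)" for \<nu> x
    unfolding h_def by (rule bessel_clifford_square_deriv)
  have nz: "h (\<mu> + 1) x \<noteq> 0"
    using bessel_clifford_pos[of "\<mu> + 1" "x\<^sup>2 / 4"] \<mu> by (simp add: h_def)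
  have rec: "h (\<mu> + 2) x = 4 * (h \<mu> x - (\<mu> + 1) * h (\<mu> + 1) x) / x\<^sup>2"
    using bessel_clifford_recurrence[of \<mu> "x\<^sup>2 / 4"] x by (simp add: h_def field_simps)
  have "(bessel_quotient \<mu> has_real_derivative ((2 * (x / 2 * h (\<mu> + 1) x)) * (x * h (\<mu> + 1) x)
      - (2 * h \<mu> x) * (1 * h (\<mu> + 1) x + x / 2 * h (\<mu> + 1 + 1) x * x)) / ((x * h (\<mu> + 1) x) * (x * h (\<mu> + 1) x))) (at x)"
    unfolding bessel_quotient_def[abs_def] h_def[symmetric] using x nz
    by (intro DERIV_divide DERIV_mult DERIV_cmult DERIV_ident hd) auto
  also have "h (\<mu> + 1 + 1) x = h (\<mu> + 2) x" by (simp add: add.assoc)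
  also have "((2 * (x / 2 * h (\<mu> + 1) x)) * (x * h (\<mu> + 1) x)
      - (2 * h \<mu> x) * (1 * h (\<mu> + 1) x + x / 2 * h (\<mu> + 2) x * x)) / ((x * h (\<mu> + 1) x) * (x * h (\<mu> + 1) x))
      = 1 + 2 * (\<mu> + 1 / 2) / x * bessel_quotient \<mu> x - (bessel_quotient \<mu> x)\<^sup>2"
    unfolding bessel_quotient_def h_def[symmetric] rec using x nz by (simp add: field_simps power2_eq_square)
  finally show ?thesis .
qed

text \<open>
  Write the ratio as \<open>N / G\<close>, with the integral as \<open>N\<close>. Then \<open>N' / G\<close> is the Bessel quotient, and by the
  recurrence the logarithmic derivative of \<open>G\<close> is the Bessel quotient plus elementary terms.
\<close>
lemma R_ratio_deriv:
  assumes \<mu>: "\<mu> > -1" and q: "q > -1" and x: "x > 0"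
  shows "(R_ratio \<mu> q \<gamma> has_real_derivative
      bessel_quotient \<mu> x - (bessel_quotient \<mu> x - \<gamma> + (q - 2 * \<mu> - 1) / x) * R_ratio \<mu> q \<gamma> x) (at x)"
proof -
  define h where "h \<nu> x = bessel_clifford \<nu> (x\<^sup>2 / 4)" for \<nu> x
  define F where "F t = t powr q * (exp (- \<gamma> * t) * h \<mu> t)" for t
  define N where "N x = integral {0..x} F" for x
  have hd: "(h \<nu> has_real_derivative x / 2 * h (\<nu> + 1) x) (at x)" for \<nu> x
    unfolding h_def by (rule bessel_clifford_square_deriv)
  have nz: "h (\<mu> + 1) x \<noteq> 0"
    using bessel_clifford_pos[of "\<mu> + 1" "x\<^sup>2 / 4"] \<mu> by (simp add: h_def)
  have rec: "h (\<mu> + 1 + 1) x = 4 * (h \<mu> x - (\<mu> + 1) * h (\<mu> + 1) x) / x\<^sup>2"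
    using bessel_clifford_recurrence[of \<mu> "x\<^sup>2 / 4"] x by (simp add: h_def field_simps)
  have "F integrable_on {0..x + 1}" unfolding F_def h_def
    by (intro powr_times_continuous_integrable[OF q] continuous_intros continuous_on_bessel_clifford_square)
  moreover have "isCont F x" unfolding F_def
    by (intro continuous_intros DERIV_isCont[OF hd]) (use x in auto)
  ultimately have Nd: "(N has_real_derivative F x) (at x)"
    unfolding N_def[abs_def] using x by (intro integral_from_0_deriv)
  \<comment> \<open>The denominator of the ratio, up to the constant factor \<^term>\<open>2 powr \<mu>\<close> that
    cancels against the numerator.\<close>
  define G where "G x = x powr (q + 1) * exp (- \<gamma> * x) * h (\<mu> + 1) x / 2" for x
  have G0: "G x \<noteq> 0" using x nz by (simp add: G_def)
  have Ed: "((\<lambda>x. exp (- \<gamma> * x)) has_real_derivative - \<gamma> * exp (- \<gamma> * x)) (at x)"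
    by (auto intro!: derivative_eq_intros)
  have "(G has_real_derivative
      (((q + 1) * x powr (q + 1 - 1) * exp (- \<gamma> * x) + - \<gamma> * exp (- \<gamma> * x) * x powr (q + 1)) * h (\<mu> + 1) x
        + x / 2 * h (\<mu> + 1 + 1) x * (x powr (q + 1) * exp (- \<gamma> * x))) / 2) (at x)"
    unfolding G_def[abs_def] by (intro DERIV_cdivide DERIV_mult has_real_derivative_powr Ed hd x)
  also have "x powr (q + 1 - 1) = x powr (q + 1) / x"
    using x by (simp only: powr_diff powr_one)
  also have "(((q + 1) * (x powr (q + 1) / x) * exp (- \<gamma> * x) + - \<gamma> * exp (- \<gamma> * x) * x powr (q + 1)) * h (\<mu> + 1) x
        + x / 2 * h (\<mu> + 1 + 1) x * (x powr (q + 1) * exp (- \<gamma> * x))) / 2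
      = G x * ((q + 1) / x - \<gamma> + x / 2 * h (\<mu> + 1 + 1) x / h (\<mu> + 1) x)"
    unfolding G_def using x nz by (simp add: field_simps)
  also have "(q + 1) / x - \<gamma> + x / 2 * h (\<mu> + 1 + 1) x / h (\<mu> + 1) x = bessel_quotient \<mu> x - \<gamma> + (q - 2 * \<mu> - 1) / x"
    unfolding rec bessel_quotient_def h_def[symmetric] using x nz by (simp add: field_simps power2_eq_square)
  finally have Gd: "(G has_real_derivative G x * (bessel_quotient \<mu> x - \<gamma> + (q - 2 * \<mu> - 1) / x)) (at x)" .
  have FG: "F x = bessel_quotient \<mu> x * G x"
    unfolding F_def G_def bessel_quotient_def h_def[symmetric] using x nz by (simp add: powr_add field_simps)
  have R: "R_ratio \<mu> q \<gamma> y = N y / G y" if "y > 0" for y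
  proof -
    have "exp (- \<gamma> * y) = 1 / exp (\<gamma> * y)" by (simp add: exp_minus inverse_eq_divide)
    then have "N y / G y = 2 * (N y / y powr (q + 1) * exp (\<gamma> * y)) / h (\<mu> + 1) y"
      unfolding G_def by simp
    then show ?thesis
      using R_ratio_eq_bessel_clifford[OF that, of \<mu> q \<gamma>] by (simp only: N_def F_def[abs_def] h_def)
  qed
  have "((\<lambda>y. N y / G y) has_real_derivative
      (F x * G x - N x * (G x * (bessel_quotient \<mu> x - \<gamma> + (q - 2 * \<mu> - 1) / x))) / (G x * G x)) (at x)"
    by (intro DERIV_divide Nd Gd G0)
  also have "(F x * G x - N x * (G x * (bessel_quotient \<mu> x - \<gamma> + (q - 2 * \<mu> - 1) / x))) / (G x * G x)
      = bessel_quotient \<mu> x - (bessel_quotient \<mu> x - \<gamma> + (q - 2 * \<mu> - 1) / x) * R_ratio \<mu> q \<gamma> x"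
    unfolding R[OF x] FG using G0 by (simp add: diff_divide_distrib)
  finally show ?thesis
    by (rule has_field_derivative_transform_within_open[where S = "{0<..}"]) (use x R in auto)
qed

theorem proposition6p2:
  fixes \<mu> q \<gamma> :: real
  assumes "\<mu> > -1" and "q > -1" and "0 < \<gamma>" and "\<gamma> < 1"
  shows
    "(\<lambda>x. R_ratio \<mu> q \<gamma> x
          - 2 * (\<mu> + 1) / (q + 1) *
            (1 + \<gamma> * x / (q + 2)
               + (\<gamma>\<^sup>2 / ((q + 2) * (q + 3))
                  + (q + 1) / (4 * (\<mu> + 1) * (q + 3))
                  - 1 / (4 * (\<mu> + 2))) * x\<^sup>2))
       \<in> O[at_right 0](\<lambda>x. x ^ 3)
     \<and> (\<lambda>x. R_ratio \<mu> q \<gamma> x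
            - (1 / (1 - \<gamma>)
               + ((\<mu> + 1 / 2) * (2 - \<gamma>) - q) / ((1 - \<gamma>)\<^sup>2 * x)))
       \<in> O[at_top](\<lambda>x. 1 / x\<^sup>2)"
proof
  show "(\<lambda>x. R_ratio \<mu> q \<gamma> x
          - 2 * (\<mu> + 1) / (q + 1) *
            (1 + \<gamma> * x / (q + 2)
               + (\<gamma>\<^sup>2 / ((q + 2) * (q + 3))
                  + (q + 1) / (4 * (\<mu> + 1) * (q + 3))
                  - 1 / (4 * (\<mu> + 2))) * x\<^sup>2))
       \<in> O[at_right 0](\<lambda>x. x ^ 3)"
    by (rule R_ratio_expansion_0) (use assms in auto)
next
  have pos: "bessel_quotient \<mu> x > 0" if "x > 0" for x
    using bessel_clifford_pos[of \<mu> "x\<^sup>2 / 4"] bessel_clifford_pos[of "\<mu> + 1" "x\<^sup>2 / 4"] assms that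
    by (simp add: bessel_quotient_def)
  have u: "(\<lambda>x. bessel_quotient \<mu> x - (1 + (\<mu> + 1 / 2) / x)) \<in> O(\<lambda>x. 1 / x\<^sup>2)"
    by (rule riccati_expansion[OF bessel_quotient_riccati[OF assms(1)] pos])
  have "(\<lambda>x. R_ratio \<mu> q \<gamma> x - (1 / (1 - \<gamma>) + ((1 - \<gamma>) * (\<mu> + 1 / 2) - (\<mu> + 1 / 2)
      - (q - 2 * \<mu> - 1)) / ((1 - \<gamma>)\<^sup>2 * x))) \<in> O(\<lambda>x. 1 / x\<^sup>2)"
    using R_ratio_deriv[OF assms(1,2)] assms
    by (intro linear_ode_expansion[OF _ u]) auto
  also have "(1 - \<gamma>) * (\<mu> + 1 / 2) - (\<mu> + 1 / 2) - (q - 2 * \<mu> - 1) = (\<mu> + 1 / 2) * (2 - \<gamma>) - q"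
    by (simp add: field_simps)
  finally show "(\<lambda>x. R_ratio \<mu> q \<gamma> x - (1 / (1 - \<gamma>) + ((\<mu> + 1 / 2) * (2 - \<gamma>) - q) / ((1 - \<gamma>)\<^sup>2 * x)))
       \<in> O[at_top](\<lambda>x. 1 / x\<^sup>2)" .
qed

end
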